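(* Let $k\ge2$ be an integer, $\varepsilon_k=1/k$, $X$ uniform over $[0,1)$, and assume that $s:[0,1)\to\mathbb{R}$ is differentiable and that $C_2>0$ satisfies $|s(t)-s(x)-s'(x)(t-x)|\le C_2(t-x)^2$ for all $t,x\in[0,1)$. Write $\mathcal{B}(x)=\mathcal{B}_{\mathcal{U}_k^{\mathtt{toy}},\infty}(x)$ and $\mathcal{V}(x)=\mathcal{V}_{\mathcal{U}_k^{\mathtt{toy}}}(x)$. Then for every $x\in[\varepsilon_k,1-\varepsilon_k]$, $$\mathcal{B}(x)\le\frac{C_2^2}{36k^4},\qquad \Big|\mathcal{V}(x)-\frac{(s'(x))^2}{12k^2}\Big|\le\frac{2\|s'\|_\infty C_2+C_2^2}{k^3},$$ and, for every $x\in(0,1)\setminus[\varepsilon_k,1-\varepsilon_k]$, $$\mathcal{B}(x)\le\frac{(s'(x))^2}{16k^2}+\frac{C_2\|s'\|_\infty+C_2^2}{2k^3},\qquad \Big|\mathcal{V}(x)-\frac{(s'(x))^2\,Q(k\min\{x,1-x\})}{k^2}\Big|\le\frac{2\|s'\|_\infty C_2+C_2^2}{k^3},$$ for some polynomial $Q$ (not depending on $x$, $k$ or $s$) with $\sup_{t\in[0,1]}|Q(t)|\le1$. As a consequence, $$\int_0^1\mathcal{B}(x)\,dx\le\frac{\|s'\|_\infty^2}{8k^3}+\frac{C_2\|s'\|_\infty+2C_2^2}{k^4},$$ $$\Big|\int_0^1\mathcal{V}(x)\,dx-\frac1{12k^2}\int_0^1(s'(x))^2dx\Big|\le\frac{2\|s'\|_\infty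 C_2+C_2^2+3\|s'\|_\infty^2}{k^3},$$ $$\int_{\varepsilon_k}^{1-\varepsilon_k}\mathcal{B}(x)\,dx\le\frac{C_2^2}{36k^4}.$$
   Context: $\mathbb{U}\sim\mathcal{U}_k^{\mathtt{toy}}$ means $\mathbb{U}=\{[0,\frac{1-T}{k}),[\frac{1-T}{k},\frac{2-T}{k}),\dots,[\frac{k-T}{k},1)\}$ with $T$ uniform over $[0,1)$. For a partition $\mathbb{U}$ of $[0,1)$ into intervals, $I_{\mathbb{U}}(x)$ is the cell containing $x$ and $\tilde s_{\mathbb{U}}(x)=\mathbb{E}[s(X)\mid X\in I_{\mathbb{U}}(x)]=\frac1{|I_{\mathbb{U}}(x)|}\int_{I_{\mathbb{U}}(x)}s(t)dt$. For a distribution $\mathcal{U}$ on partitions, $\mathcal{B}_{\mathcal{U},\infty}(x)=(s(x)-\mathbb{E}_{\mathbb{U}\sim\mathcal{U}}[\tilde s_{\mathbb{U}}(x)])^2$ and $\mathcal{V}_{\mathcal{U}}(x)=\operatorname{var}_{\mathbb{U}\sim\mathcal{U}}(\tilde s_{\mathbb{U}}(x))$. $\|\cdot\|_\infty$ is the sup-norm on $[0,1)$. *)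

theory Defs
  imports "HOL-Probability.Probability" "HOL-Computational_Algebra.Polynomial"
begin

text \<open>The uniform distribution on [0,1), carried by [0,1) itself: measurability of a function
  with respect to it constrains the function on [0,1) only.\<close>

definition unif01 :: "real measure" where
  "unif01 = restrict_space lborel {0..<1}"

lemma prob_space_unif01: "prob_space unif01"
  by (intro prob_spaceI)
     (simp add: unif01_def space_restrict_space emeasure_restrict_space)

definition cell :: "real set set \<Rightarrow> real \<Rightarrow> real set" where
  "cell U x = (THE I. I \<in> U \<and> x \<in> I)"

text \<open>The value at x of the projection of s on the functions that are constant on each cell of U:
  the elementary conditional expectation of s(X) given that X lies in the cell of x, where P is
  the law of X.\<close>

definition cell_mean :: "real measure \<Rightarrow> (real \<Rightarrow> real) \<Rightarrow> real set set \<Rightarrow> real \<Rightarrow> real" where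
  "cell_mean P s U x = (LINT t:cell U x|P. s t) / measure P (cell U x)"

text \<open>A distribution on partitions is given by a random partition: a probability space M together
  with a map U from its outcomes to partitions.\<close>

definition bias_infinite ::
  "real measure \<Rightarrow> 'w measure \<Rightarrow> ('w \<Rightarrow> real set set) \<Rightarrow> (real \<Rightarrow> real) \<Rightarrow> real \<Rightarrow> real" where
  "bias_infinite P M U s x = (s x - prob_space.expectation M (\<lambda>w. cell_mean P s (U w) x))\<^sup>2"

definition partition_var ::
  "real measure \<Rightarrow> 'w measure \<Rightarrow> ('w \<Rightarrow> real set set) \<Rightarrow> (real \<Rightarrow> real) \<Rightarrow> real \<Rightarrow> real" where
  "partition_var P M U s x = prob_space.variance M (\<lambda>w. cell_mean P s (U w) x)"

text \<open>For T = 0 the last cell is empty.\<close>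

definition toy_partition :: "nat \<Rightarrow> real \<Rightarrow> real set set" where
  "toy_partition k T =
     {{0..<(1 - T) / real k}}
     \<union> {{(real j - T) / real k..<(real (Suc j) - T) / real k} |j. 1 \<le> j \<and> j < k}
     \<union> {{(real k - T) / real k..<1}}"

lemma toy_partition_ex1:
  assumes "k \<ge> 2" "0 \<le> T" "T < 1" "0 \<le> x" "x < 1"
  shows "\<exists>!I. I \<in> toy_partition k T \<and> x \<in> I"
proof -
  define n where "n = nat \<lfloor>real k * x + T\<rfloor>"
  define C where "C = (\<lambda>j. {max 0 ((real j - T) / real k)..<min 1 ((real (Suc j) - T) / real k)})"
  have k: "real k > 0" using assms by simp
  have "real k * x < real k" using assms k by simp
  have *: "toy_partition k T = C ` {..k}"
  proof -
    have C0: "C 0 = {0..<(1 - T) / real k}"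
      using assms k by (auto simp: C_def max_def min_def field_simps)
    have Ck: "C k = {(real k - T) / real k..<1}"
      using assms k by (auto simp: C_def max_def min_def field_simps)
    have Cj: "C j = {(real j - T) / real k..<(real (Suc j) - T) / real k}" if "1 \<le> j" "j < k" for j
    proof -
      have "real j \<ge> 1" "real (Suc j) \<le> real k" using that by linarith+
      then have "0 \<le> (real j - T) / real k" "(real (Suc j) - T) / real k \<le> 1"
        using assms k by (simp_all add: field_simps)
      then show ?thesis by (simp add: C_def max_absorb2 min_absorb2)
    qed
    have "{..k} = {0} \<union> {j. 1 \<le> j \<and> j < k} \<union> {k}" by auto
    then have "C ` {..k} = {C 0} \<union> C ` {j. 1 \<le> j \<and> j < k} \<union> {C k}" by auto
    also have "C ` {j. 1 \<le> j \<and> j < k} =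
        {{(real j - T) / real k..<(real (Suc j) - T) / real k} |j. 1 \<le> j \<and> j < k}"
      using Cj by (auto simp: image_iff)
    finally show ?thesis by (simp add: toy_partition_def C0 Ck)
  qed
  have mem: "x \<in> C j \<longleftrightarrow> j = n" for j
  proof -
    have "x \<in> C j \<longleftrightarrow> real j \<le> real k * x + T \<and> real k * x + T < real j + 1"
      using assms k by (auto simp: C_def field_simps)
    also have "\<dots> \<longleftrightarrow> \<lfloor>real k * x + T\<rfloor> = int j" by (simp add: floor_eq_iff)
    also have "\<dots> \<longleftrightarrow> j = n" using assms k by (auto simp: n_def)
    finally show ?thesis .
  qed
  have "real k * x + T < real k + 1"
    using \<open>real k * x < real k\<close> \<open>T < 1\<close> by linarith
  then have "\<lfloor>real k * x + T\<rfloor> < int k + 1" by linarith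
  then have "n \<le> k" by (simp add: n_def)
  then show ?thesis unfolding * using mem by auto
qed

text \<open>Meaningful only for functions that are bounded on [0,1).\<close>

definition sup_norm :: "(real \<Rightarrow> real) \<Rightarrow> real" where
  "sup_norm f = (SUP x\<in>{0..<1}. \<bar>f x\<bar>)"

end

theory Submission
  imports Defs
begin

text \<open>
  Fix \<open>x\<close> in \<open>[0,1)\<close> and let \<open>[a, b)\<close> be the cell of \<open>x\<close> for the shift \<open>T\<close>. Integrating the quadratic
  Taylor bound over the cell gives

    \<open>mean of s over the cell = s x + s' x * Z / k + R\<close>, where \<open>Z = k * ((a + b) / 2 - x)\<close>,

  the rescaled displacement of the cell midpoint from \<open>x\<close>, satisfies \<open>\<bar>Z\<bar> \<le> 1/2\<close>, and
  \<open>\<bar>R\<bar> \<le> C2 / k^2 * (1/12 + Z^2)\<close>, because the integral of \<open>(t - x)^2\<close> over \<open>[a, b)\<close> divided by the length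
  is \<open>(b - a)^2 / 12 + ((a + b) / 2 - x)^2\<close> and \<open>b - a \<le> 1/k\<close> (\<open>toy_mean_remainder\<close>). Hence bias and variance
  are those of the affine function \<open>s x + s' x * Z / k\<close> up to a small perturbation
  (\<open>affine_perturbation\<close>), and only the first two moments of \<open>Z\<close> under the uniform law of \<open>T\<close> are needed.

  As a function of \<open>T\<close>, \<open>Z\<close> consists of two affine pieces. For \<open>x\<close> in \<open>[1/k, 1 - 1/k]\<close> the cell is never
  truncated, \<open>Z\<close> is uniform on an interval of length 1 centred at 0, and its moments are \<open>0\<close> and \<open>1/12\<close>
  (\<open>toy_moments_interior\<close>). Otherwise, with \<open>t = k * min x (1 - x)\<close>, the mean of \<open>Z\<close> is \<open>(1 - t)^2 / 4\<close> in
  absolute value and its variance is \<open>1/48 + t^2/8 - t^4/16\<close>, which is the polynomial \<open>Q\<close>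
  (\<open>toy_moments_boundary\<close>).

  The bounds on the integrals over \<open>[0,1)\<close> add the interior bound over \<open>[0,1)\<close> to the excess over the two boundary
  intervals of length \<open>1/k\<close> (\<open>set_integral_le_two_levels\<close>). Integrability holds because bias and variance
  are bounded on \<open>(0,1)\<close> and because the mean over the cell is jointly measurable in \<open>x\<close> and \<open>T\<close>.
\<close>

section \<open>Integrals over half-open intervals\<close>

lemma set_integral_FTC_Ico:
  fixes f F :: "real \<Rightarrow> real"
  assumes "a \<le> b" "\<And>t. (F has_real_derivative f t) (at t)" "continuous_on UNIV f"
  shows "set_integrable lborel {a..<b} f" "(LBINT t:{a..<b}. f t) = F b - F a"
proof -
  have c: "isCont f t" for t
    using assms(3) continuous_on_eq_continuous_at open_UNIV by blast
  have I: "has_bochner_integral lborel (\<lambda>x. f x * indicator {a .. b} x) (F b - F a)"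
    by (rule has_bochner_integral_FTC_Icc_real) (use assms c in auto)
  have [measurable]: "f \<in> borel_measurable borel"
    using assms(3) by (rule borel_measurable_continuous_onI)
  have ae: "AE t in lborel. f t * indicator {a .. b} t = indicator {a..<b} t * f t"
    using AE_lborel_singleton[of b] by eventually_elim (auto simp: indicator_def)
  have "has_bochner_integral lborel (\<lambda>t. indicator {a..<b} t * f t) (F b - F a)"
    using I by (subst has_bochner_integral_cong_AE[symmetric, OF _ _ ae]) auto
  then show "set_integrable lborel {a..<b} f" "(LBINT t:{a..<b}. f t) = F b - F a"
    by (auto simp: set_integrable_def set_lebesgue_integral_def has_bochner_integral_iff)
qed

text \<open>No bound is needed at the null set \<open>{0}\<close>.\<close>

lemma set_integrable_boundedI:
  fixes f :: "real \<Rightarrow> real"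
  assumes "(\<lambda>x. indicator {0..<1} x * f x) \<in> borel_measurable borel"
    and "\<And>x. x \<in> {0<..<1} \<Longrightarrow> \<bar>f x\<bar> \<le> b"
  shows "set_integrable lborel {0..<1} f"
proof -
  have "AE x in lborel. x \<in> {0..<1} \<longrightarrow> norm (indicator {0..<1} x * f x) \<le> b"
    using AE_lborel_singleton[of 0] by eventually_elim (use assms(2) in auto)
  then show ?thesis
    unfolding set_integrable_def real_scaleR_def
    by (intro integrableI_bounded_set[where A = "{0..<1}" and B = b]) (use assms(1) in auto)
qed

text \<open>The point 0 is excluded from the hypotheses when \<open>\<delta> > 0\<close>; it is a null set.\<close>

lemma set_integral_le_two_levels:
  fixes f :: "real \<Rightarrow> real"
  assumes "0 \<le> \<delta>" "\<delta> \<le> 1 / 2" "0 \<le> b"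
    and f: "set_integrable lborel {0..<1} f"
    and int: "\<And>x. x \<in> {\<delta>..1 - \<delta>} \<Longrightarrow> f x \<le> a"
    and bd: "\<And>x. x \<in> {0<..<1} - {\<delta>..1 - \<delta>} \<Longrightarrow> f x \<le> a + b"
  shows "(LBINT x:{0..<1}. f x) \<le> a + 2 * \<delta> * b"
proof -
  let ?g = "\<lambda>x. a * indicator {0..<1} x + (b * indicator {0..<\<delta>} x + b * indicator {1 - \<delta>..<1} x) :: real"
  have "(LBINT x:{0..<1}. f x) \<le> (\<integral>x. ?g x \<partial>lborel)"
    unfolding set_lebesgue_integral_def real_scaleR_def
  proof (rule integral_mono_AE)
    show "integrable lborel (\<lambda>x. indicator {0..<1} x * f x)"
      using f by (simp add: set_integrable_def)
    show "integrable lborel ?g"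
      using assms(1)
      by (intro Bochner_Integration.integrable_add integrable_mult_right integrable_real_indicator) auto
    have le: "indicator {0..<1} x * f x \<le> ?g x" if "x \<noteq> 0" for x
    proof (cases "x \<in> {0<..<1}")
      case True
      then consider "x \<in> {\<delta>..1 - \<delta>}" | "0 < x" "x < \<delta>" | "1 - \<delta> < x" "x < 1" by force
      then show ?thesis
        using int[of x] bd[of x] True \<open>0 \<le> b\<close> assms(2) by cases (auto simp: indicator_def)
    next
      case False
      then show ?thesis using that assms by (auto simp: indicator_def)
    qed
    show "AE x in lborel. indicator {0..<1} x * f x \<le> ?g x"
      using AE_lborel_singleton[of 0] by eventually_elim (use le in auto)
  qed
  also have "(\<integral>x. ?g x \<partial>lborel) = a + (b * \<delta> + b * \<delta>)"
  proof -
    have i: "integrable lborel (indicator {c..<d} :: real \<Rightarrow> real)" if "c \<le> d" for c d :: real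
      using that by (intro integrable_real_indicator) auto
    show ?thesis
      using assms(1,2) i by simp
  qed
  finally show ?thesis by simp
qed

section \<open>The uniform distribution on the unit interval\<close>

lemma integral_unif01: "integral\<^sup>L unif01 g = (LBINT t:{0..<1}. g t)" for g :: "real \<Rightarrow> real"
  by (simp add: unif01_def integral_restrict_space set_lebesgue_integral_def)

lemma space_unif01 [simp]: "space unif01 = {0..<1}"
  by (simp add: unif01_def space_restrict_space)

lemma borel_measurable_unif01I: "g \<in> borel_measurable borel \<Longrightarrow> g \<in> borel_measurable unif01"
  unfolding unif01_def by (intro measurable_restrict_space1) simp

lemma integral_unif01_two_pieces:
  fixes g :: "real \<Rightarrow> real"
  assumes p: "0 \<le> p" "p \<le> 1"
    and g1: "\<And>T. 0 \<le> T \<Longrightarrow> T < p \<Longrightarrow> g T = f1 T"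
    and g2: "\<And>T. p \<le> T \<Longrightarrow> T < 1 \<Longrightarrow> g T = f2 T"
    and F1: "\<And>T. (F1 has_real_derivative f1 T) (at T)" "continuous_on UNIV f1"
    and F2: "\<And>T. (F2 has_real_derivative f2 T) (at T)" "continuous_on UNIV f2"
  shows "integral\<^sup>L unif01 g = (F1 p - F1 0) + (F2 1 - F2 p)"
proof -
  note i1 = set_integral_FTC_Ico[OF p(1) F1]
  note i2 = set_integral_FTC_Ico[OF p(2) F2]
  have j1: "set_integrable lborel {0..<p} g"
    using i1(1) g1 by (subst set_integrable_cong[where f' = f1]) auto
  have j2: "set_integrable lborel {p..<1} g"
    using i2(1) g2 by (subst set_integrable_cong[where f' = f2]) auto
  have "{0..<1} = {0..<p} \<union> {p..<1}" using p by auto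
  then have "(LBINT t:{0..<1}. g t) = (LBINT t:{0..<p}. g t) + (LBINT t:{p..<1}. g t)"
    using set_integral_Un[OF _ j1 j2] by auto
  also have "(LBINT t:{0..<p}. g t) = (LBINT t:{0..<p}. f1 t)"
    by (rule set_lebesgue_integral_cong) (use g1 in auto)
  also have "(LBINT t:{p..<1}. g t) = (LBINT t:{p..<1}. f2 t)"
    by (rule set_lebesgue_integral_cong) (use g2 in auto)
  finally show ?thesis by (simp add: integral_unif01 i1(2) i2(2))
qed

lemma moments_unif01_two_affine_pieces:
  fixes Z :: "real \<Rightarrow> real"
  assumes p: "0 \<le> p" "p \<le> 1"
    and Z1: "\<And>T. 0 \<le> T \<Longrightarrow> T < p \<Longrightarrow> Z T = a1 + b1 * T"
    and Z2: "\<And>T. p \<le> T \<Longrightarrow> T < 1 \<Longrightarrow> Z T = a2 + b2 * T"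
  shows "integral\<^sup>L unif01 Z = a1 * p + b1 * p\<^sup>2 / 2 + a2 * (1 - p) + b2 * (1 - p\<^sup>2) / 2"
    and "integral\<^sup>L unif01 (\<lambda>T. (Z T)\<^sup>2) =
           a1\<^sup>2 * p + a1 * b1 * p\<^sup>2 + b1\<^sup>2 * p ^ 3 / 3
           + a2\<^sup>2 * (1 - p) + a2 * b2 * (1 - p\<^sup>2) + b2\<^sup>2 * (1 - p ^ 3) / 3"
proof -
  have "integral\<^sup>L unif01 Z = ((a1 * p + b1 * p\<^sup>2 / 2) - (a1 * 0 + b1 * 0\<^sup>2 / 2))
      + ((a2 * 1 + b2 * 1\<^sup>2 / 2) - (a2 * p + b2 * p\<^sup>2 / 2))"
    by (rule integral_unif01_two_pieces[OF p,
          where ?f1.0 = "\<lambda>T. a1 + b1 * T" and ?f2.0 = "\<lambda>T. a2 + b2 * T"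
            and ?F1.0 = "\<lambda>T. a1 * T + b1 * T\<^sup>2 / 2" and ?F2.0 = "\<lambda>T. a2 * T + b2 * T\<^sup>2 / 2"])
       (auto intro!: derivative_eq_intros continuous_intros simp: Z1 Z2)
  then show "integral\<^sup>L unif01 Z = a1 * p + b1 * p\<^sup>2 / 2 + a2 * (1 - p) + b2 * (1 - p\<^sup>2) / 2"
    by (simp add: field_simps)
  have "integral\<^sup>L unif01 (\<lambda>T. (Z T)\<^sup>2) =
      ((a1\<^sup>2 * p + a1 * b1 * p\<^sup>2 + b1\<^sup>2 * p ^ 3 / 3) - (a1\<^sup>2 * 0 + a1 * b1 * 0\<^sup>2 + b1\<^sup>2 * 0 ^ 3 / 3))
      + ((a2\<^sup>2 * 1 + a2 * b2 * 1\<^sup>2 + b2\<^sup>2 * 1 ^ 3 / 3) - (a2\<^sup>2 * p + a2 * b2 * p\<^sup>2 + b2\<^sup>2 * p ^ 3 / 3))"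
    by (rule integral_unif01_two_pieces[OF p,
          where ?f1.0 = "\<lambda>T. (a1 + b1 * T)\<^sup>2" and ?f2.0 = "\<lambda>T. (a2 + b2 * T)\<^sup>2"
            and ?F1.0 = "\<lambda>T. a1\<^sup>2 * T + a1 * b1 * T\<^sup>2 + b1\<^sup>2 * T ^ 3 / 3"
            and ?F2.0 = "\<lambda>T. a2\<^sup>2 * T + a2 * b2 * T\<^sup>2 + b2\<^sup>2 * T ^ 3 / 3"])
       (auto intro!: derivative_eq_intros continuous_intros simp: Z1 Z2 power2_eq_square algebra_simps)
  then show "integral\<^sup>L unif01 (\<lambda>T. (Z T)\<^sup>2) =
           a1\<^sup>2 * p + a1 * b1 * p\<^sup>2 + b1\<^sup>2 * p ^ 3 / 3
           + a2\<^sup>2 * (1 - p) + a2 * b2 * (1 - p\<^sup>2) + b2\<^sup>2 * (1 - p ^ 3) / 3"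
    by (simp add: field_simps)
qed

section \<open>Perturbed affine functions of a random variable\<close>

text \<open>With \<open>Y = d + c * Z + R\<close> the error in the variance is twice \<open>c\<close> times the
  covariance of \<open>Z\<close> and \<open>R\<close>, plus the variance of \<open>R\<close>, and \<open>\<bar>R\<bar> \<le> A / 3\<close>.\<close>

lemma (in prob_space) affine_perturbation:
  fixes Y Z :: "'a \<Rightarrow> real"
  assumes [measurable]: "Z \<in> borel_measurable M" "Y \<in> borel_measurable M"
    and Z: "\<And>w. w \<in> space M \<Longrightarrow> \<bar>Z w\<bar> \<le> 1 / 2"
    and Y: "\<And>w. w \<in> space M \<Longrightarrow> \<bar>Y w - (d + c * Z w)\<bar> \<le> A * (1 / 12 + (Z w)\<^sup>2)"
    and A: "A \<ge> 0"
  shows "\<bar>expectation Y - (d + c * expectation Z)\<bar> \<le> A * (1 / 12 + expectation (\<lambda>w. (Z w)\<^sup>2))"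
    and "\<bar>variance Y - c\<^sup>2 * (expectation (\<lambda>w. (Z w)\<^sup>2) - (expectation Z)\<^sup>2)\<bar> \<le> 2 * \<bar>c\<bar> * A / 3 + A\<^sup>2 / 9"
proof -
  define R where "R w = Y w - (d + c * Z w)" for w
  have [measurable]: "R \<in> borel_measurable M" unfolding R_def by measurable
  have Z2: "(Z w)\<^sup>2 \<le> 1 / 4" if "w \<in> space M" for w
    using Z[OF that] abs_le_square_iff[of "Z w" "1/2"] by (simp add: power2_eq_square)
  have R1: "\<bar>R w\<bar> \<le> A * (1 / 12 + (Z w)\<^sup>2)" if "w \<in> space M" for w
    using Y[OF that] by (simp add: R_def)
  have R3: "\<bar>R w\<bar> \<le> A / 3" if "w \<in> space M" for w
    using R1[OF that] mult_left_mono[OF Z2[OF that] A] by (simp add: algebra_simps)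
  have bnd: "integrable M f" if "f \<in> borel_measurable M" "\<And>w. w \<in> space M \<Longrightarrow> \<bar>f w\<bar> \<le> b"
    for f :: "'a \<Rightarrow> real" and b
    using that by (intro integrable_const_bound[where B = b]) auto
  have iZ: "integrable M Z" by (rule bnd[OF _ Z]) auto
  have iZ2: "integrable M (\<lambda>w. (Z w)\<^sup>2)" by (rule bnd[of _ "1/4"]) (use Z2 in auto)
  have iR: "integrable M R" by (rule bnd[OF _ R3]) auto
  have R2: "(R w)\<^sup>2 \<le> A\<^sup>2 / 9" if "w \<in> space M" for w
    using R3[OF that] power_mono[of "\<bar>R w\<bar>" "A/3" 2] by (simp add: power_divide)
  have iR2: "integrable M (\<lambda>w. (R w)\<^sup>2)" by (rule bnd[of _ "A\<^sup>2/9"]) (use R2 in auto)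
  have ZR: "\<bar>Z w * R w\<bar> \<le> A / 6" if "w \<in> space M" for w
    using mult_mono[OF Z[OF that] R3[OF that]] by (simp add: abs_mult)
  have iZR: "integrable M (\<lambda>w. Z w * R w)" by (rule bnd[OF _ ZR]) auto
  have Yeq: "Y = (\<lambda>w. d + c * Z w + R w)" by (auto simp: R_def)
  have EY: "expectation Y = d + c * expectation Z + expectation R"
    unfolding Yeq using iZ iR by (simp add: prob_space)
  have ER: "\<bar>expectation R\<bar> \<le> A * (1 / 12 + expectation (\<lambda>w. (Z w)\<^sup>2))"
  proof -
    have "\<bar>expectation R\<bar> \<le> expectation (\<lambda>w. \<bar>R w\<bar>)" by (rule integral_abs_bound)
    also have "\<dots> \<le> expectation (\<lambda>w. A * (1 / 12 + (Z w)\<^sup>2))"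
      using iR iZ2 R1 by (intro integral_mono) auto
    also have "\<dots> = A * (1 / 12 + expectation (\<lambda>w. (Z w)\<^sup>2))"
      using iZ2 by (simp add: prob_space)
    finally show ?thesis .
  qed
  then show "\<bar>expectation Y - (d + c * expectation Z)\<bar> \<le> A * (1 / 12 + expectation (\<lambda>w. (Z w)\<^sup>2))"
    by (simp add: EY)
  have abs_le: "\<bar>expectation f\<bar> \<le> b" if "integrable M f" "\<And>w. w \<in> space M \<Longrightarrow> \<bar>f w\<bar> \<le> b"
    for f :: "'a \<Rightarrow> real" and b
  proof -
    have "\<bar>expectation f\<bar> \<le> expectation (\<lambda>w. \<bar>f w\<bar>)" by (rule integral_abs_bound)
    also have "\<dots> \<le> expectation (\<lambda>w. b)"
      using that by (intro integral_mono) auto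
    finally show ?thesis by (simp add: prob_space)
  qed
  define z r where "z = expectation Z" and "r = expectation R"
  have zr: "\<bar>z * r\<bar> \<le> A / 6"
    using mult_mono[OF abs_le[OF iZ Z] abs_le[OF iR R3]] by (simp add: abs_mult z_def r_def)
  \<comment> \<open>\<open>q\<close> is the covariance of \<open>Z\<close> and \<open>R\<close>, and \<open>v\<close> is the variance of \<open>R\<close>.\<close>
  define q where "q = expectation (\<lambda>w. Z w * R w) - z * r"
  have q: "\<bar>q\<bar> \<le> A / 3"
    using abs_le[OF iZR ZR] zr unfolding q_def by linarith
  define v where "v = expectation (\<lambda>w. (R w)\<^sup>2) - r\<^sup>2"
  have "0 \<le> variance R" by (intro integral_nonneg_AE) auto
  then have "0 \<le> v" using variance_eq[OF iR iR2] by (simp add: v_def r_def)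
  moreover have "\<bar>expectation (\<lambda>w. (R w)\<^sup>2)\<bar> \<le> A\<^sup>2 / 9"
    by (rule abs_le[OF iR2]) (use R2 in auto)
  then have "v \<le> A\<^sup>2 / 9"
    using zero_le_power2[of r] unfolding v_def by linarith
  ultimately have v: "\<bar>v\<bar> \<le> A\<^sup>2 / 9" by simp
  have "variance Y = expectation (\<lambda>w. c\<^sup>2 * (Z w)\<^sup>2 + 2 * c * (Z w * R w) + (R w)\<^sup>2
      - 2 * (c * z + r) * (c * Z w + R w) + (c * z + r)\<^sup>2)"
    unfolding EY unfolding Yeq z_def[symmetric] r_def[symmetric]
    by (intro Bochner_Integration.integral_cong) (auto simp: power2_eq_square algebra_simps)
  also have "\<dots> = c\<^sup>2 * expectation (\<lambda>w. (Z w)\<^sup>2) + 2 * c * expectation (\<lambda>w. Z w * R w)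
      + expectation (\<lambda>w. (R w)\<^sup>2) - 2 * (c * z + r) * (c * z + r) + (c * z + r)\<^sup>2"
    using iZ iR iZ2 iR2 iZR by (simp add: prob_space z_def r_def)
  also have "\<dots> = c\<^sup>2 * (expectation (\<lambda>w. (Z w)\<^sup>2) - z\<^sup>2) + 2 * c * q + v"
    by (simp add: q_def v_def power2_eq_square algebra_simps)
  finally have "\<bar>variance Y - c\<^sup>2 * (expectation (\<lambda>w. (Z w)\<^sup>2) - z\<^sup>2)\<bar> = \<bar>2 * c * q + v\<bar>" by simp
  also have "\<dots> \<le> 2 * \<bar>c\<bar> * \<bar>q\<bar> + \<bar>v\<bar>"
    using abs_triangle_ineq[of "2 * c * q" v] by (simp add: abs_mult)
  also have "\<dots> \<le> 2 * \<bar>c\<bar> * (A / 3) + A\<^sup>2 / 9"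
    by (intro add_mono v mult_left_mono q) auto
  finally show "\<bar>variance Y - c\<^sup>2 * (expectation (\<lambda>w. (Z w)\<^sup>2) - (expectation Z)\<^sup>2)\<bar> \<le> 2 * \<bar>c\<bar> * A / 3 + A\<^sup>2 / 9"
    by (simp add: z_def)
qed

section \<open>The cell of a point in the toy partition\<close>

text \<open>The end points of the cell of \<open>x\<close> for the shift \<open>T\<close> (\<open>cell_toy_partition\<close>). The cell before truncation to
  \<open>[0,1)\<close> is \<open>[(n - T)/k, (n + 1 - T)/k)\<close> where \<open>n\<close> is the floor of \<open>k * x + T\<close>. The formulas
  make sense for all real \<open>x\<close> and \<open>T\<close>, so that they are Borel functions on the plane.\<close>

definition toy_left :: "nat \<Rightarrow> real \<Rightarrow> real \<Rightarrow> real" where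
  "toy_left k x T = max 0 ((of_int \<lfloor>real k * x + T\<rfloor> - T) / real k)"

definition toy_right :: "nat \<Rightarrow> real \<Rightarrow> real \<Rightarrow> real" where
  "toy_right k x T = min 1 ((of_int \<lfloor>real k * x + T\<rfloor> + 1 - T) / real k)"

text \<open>The displacement of the midpoint of the cell from \<open>x\<close>, in units of \<open>1/k\<close>.\<close>

definition toy_offset :: "nat \<Rightarrow> real \<Rightarrow> real \<Rightarrow> real" where
  "toy_offset k x T = real k * ((toy_left k x T + toy_right k x T) / 2 - x)"

lemma toy_bounds:
  assumes "k \<ge> 2" "0 \<le> x" "x < 1"
  shows "0 \<le> toy_left k x T" "toy_left k x T \<le> x" "x < toy_right k x T" "toy_right k x T \<le> 1"
    and "toy_right k x T - toy_left k x T \<le> 1 / real k"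
    and "\<bar>toy_offset k x T\<bar> \<le> 1 / 2"
proof -
  have k: "real k > 0" using assms by simp
  define n where "n = real_of_int \<lfloor>real k * x + T\<rfloor>"
  have n: "n \<le> real k * x + T" "real k * x + T < n + 1"
    unfolding n_def by linarith+
  show 1: "0 \<le> toy_left k x T" "toy_right k x T \<le> 1"
    by (simp_all add: toy_left_def toy_right_def)
  show 2: "toy_left k x T \<le> x" "x < toy_right k x T"
    using n k assms unfolding toy_left_def toy_right_def n_def[symmetric]
    by (simp_all add: field_simps)
  have "toy_right k x T - toy_left k x T \<le> (n + 1 - T) / real k - (n - T) / real k"
    unfolding toy_left_def toy_right_def n_def[symmetric] by linarith
  also have "\<dots> = 1 / real k" using k by (simp add: field_simps)
  finally show 3: "toy_right k x T - toy_left k x T \<le> 1 / real k" .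
  have "\<bar>(l + r) / 2 - x\<bar> \<le> w / 2" if "l \<le> x" "x < r" "r - l \<le> w" for l r w :: real
    unfolding abs_le_iff using that by (simp add: field_simps)
  from mult_left_mono[OF this[OF 2 3], of "real k"] show "\<bar>toy_offset k x T\<bar> \<le> 1 / 2"
    using k by (simp add: toy_offset_def abs_mult)
qed

lemma cell_toy_partition:
  assumes "k \<ge> 2" "0 \<le> x" "x < 1" "0 \<le> T" "T < 1"
  shows "cell (toy_partition k T) x = {toy_left k x T..<toy_right k x T}"
proof -
  have k: "real k > 0" using assms by simp
  define n where "n = nat \<lfloor>real k * x + T\<rfloor>"
  have n0: "\<lfloor>real k * x + T\<rfloor> \<ge> 0" using assms k by simp
  then have n: "real_of_int \<lfloor>real k * x + T\<rfloor> = real n" by (simp add: n_def)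
  have "real k * x < real k" using assms k by simp
  then have "real n < real k + 1" using n assms by linarith
  then have "n \<le> k" by linarith
  consider "n = 0" | "1 \<le> n" "n < k" | "n = k" using \<open>n \<le> k\<close> by linarith
  then have "{toy_left k x T..<toy_right k x T} \<in> toy_partition k T"
  proof cases
    case 1
    have "toy_left k x T = 0" "toy_right k x T = (1 - T) / real k"
      using 1 n k assms by (auto simp: toy_left_def toy_right_def field_simps)
    then show ?thesis by (simp add: toy_partition_def)
  next
    case 2
    have "real n \<ge> 1" "real n + 1 \<le> real k" using 2 by linarith+
    then have "toy_left k x T = (real n - T) / real k" "toy_right k x T = (real (Suc n) - T) / real k"
      using n k assms by (auto simp: toy_left_def toy_right_def field_simps)
    then show ?thesis using 2 by (auto simp: toy_partition_def)
  next
    case 3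
    have "toy_left k x T = (real k - T) / real k" "toy_right k x T = 1"
      using 3 n k assms by (auto simp: toy_left_def toy_right_def field_simps)
    then show ?thesis by (simp add: toy_partition_def)
  qed
  moreover have "x \<in> {toy_left k x T..<toy_right k x T}"
    using toy_bounds[OF assms(1-3)] by auto
  ultimately show ?thesis
    unfolding cell_def using toy_partition_ex1[OF assms(1,4,5,2,3)] by (intro the1_equality) auto
qed

section \<open>Moments of the midpoint displacement\<close>

text \<open>The shift \<open>T = 1 - frac (k * x)\<close> is where a cell boundary passes \<open>x\<close>; it separates the two affine pieces
  of the displacement.\<close>

lemma toy_floor:
  assumes "0 \<le> T" "T < 1"
  shows "T < 1 - frac (real k * x) \<Longrightarrow> \<lfloor>real k * x + T\<rfloor> = \<lfloor>real k * x\<rfloor>"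
    and "1 - frac (real k * x) \<le> T \<Longrightarrow> \<lfloor>real k * x + T\<rfloor> = \<lfloor>real k * x\<rfloor> + 1"
  using assms by (auto simp: frac_def floor_eq_iff; linarith)+

lemma toy_offset_interior:
  assumes k: "k \<ge> 2" and x: "1 / real k \<le> x" "x \<le> 1 - 1 / real k" and T: "0 \<le> T" "T < 1"
  shows "T < 1 - frac (real k * x) \<Longrightarrow> toy_offset k x T = (1 / 2 - frac (real k * x)) + (- 1) * T"
    and "1 - frac (real k * x) \<le> T \<Longrightarrow> toy_offset k x T = (3 / 2 - frac (real k * x)) + (- 1) * T"
proof -
  have k0: "real k > 0" using k by simp
  define n where "n = real_of_int \<lfloor>real k * x + T\<rfloor>"
  have n: "n \<le> real k * x + T" "real k * x + T < n + 1"
    unfolding n_def by linarith+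
  have kx: "1 \<le> real k * x" "real k * x \<le> real k - 1"
    using x k0 by (simp_all add: field_simps)
  have "toy_left k x T = (n - T) / real k" "toy_right k x T = (n + 1 - T) / real k"
    using n kx k0 unfolding toy_left_def toy_right_def n_def[symmetric]
    by (auto simp: field_simps max_def min_def)
  then have *: "toy_offset k x T = n + 1 / 2 - T - real k * x"
    using k0 by (simp add: toy_offset_def field_simps)
  show "T < 1 - frac (real k * x) \<Longrightarrow> toy_offset k x T = (1 / 2 - frac (real k * x)) + (- 1) * T"
    unfolding * n_def using toy_floor(1)[OF T, of k x] by (simp add: frac_def)
  show "1 - frac (real k * x) \<le> T \<Longrightarrow> toy_offset k x T = (3 / 2 - frac (real k * x)) + (- 1) * T"
    unfolding * n_def using toy_floor(2)[OF T, of k x] by (simp add: frac_def)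
qed

lemma toy_offset_left:
  assumes k: "k \<ge> 2" and x: "0 \<le> x" "x < 1 / real k" and T: "0 \<le> T" "T < 1"
  shows "T < 1 - real k * x \<Longrightarrow> toy_offset k x T = (1 / 2 - real k * x) + (- 1 / 2) * T"
    and "1 - real k * x \<le> T \<Longrightarrow> toy_offset k x T = (3 / 2 - real k * x) + (- 1) * T"
proof -
  have k0: "real k \<ge> 2" using k by simp
  have kx: "0 \<le> real k * x" "real k * x < 1" using x k0 by (simp_all add: field_simps)
  then have fl: "\<lfloor>real k * x\<rfloor> = 0" "frac (real k * x) = real k * x"
    by (simp_all add: floor_eq_iff frac_eq)
  show "toy_offset k x T = (1 / 2 - real k * x) + (- 1 / 2) * T" if "T < 1 - real k * x"
  proof -
    have "\<lfloor>real k * x + T\<rfloor> = 0" using toy_floor(1)[OF T, of k x] fl that by simp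
    then have "toy_left k x T = 0" "toy_right k x T = (1 - T) / real k"
      using T k0 by (simp_all add: toy_left_def toy_right_def field_simps)
    then show ?thesis using k0 by (simp add: toy_offset_def field_simps)
  qed
  show "toy_offset k x T = (3 / 2 - real k * x) + (- 1) * T" if "1 - real k * x \<le> T"
  proof -
    have "\<lfloor>real k * x + T\<rfloor> = 1" using toy_floor(2)[OF T, of k x] fl that by simp
    then have "toy_left k x T = (1 - T) / real k" "toy_right k x T = (2 - T) / real k"
      using T k0 by (simp_all add: toy_left_def toy_right_def field_simps)
    then show ?thesis using k0 by (simp add: toy_offset_def field_simps)
  qed
qed

lemma toy_offset_right:
  assumes k: "k \<ge> 2" and x: "1 - 1 / real k < x" "x < 1" and T: "0 \<le> T" "T < 1"
  shows "T < real k * (1 - x) \<Longrightarrow> toy_offset k x T = (real k * (1 - x) - 1 / 2) + (- 1) * T"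
    and "real k * (1 - x) \<le> T \<Longrightarrow> toy_offset k x T = real k * (1 - x) + (- 1 / 2) * T"
proof -
  have k0: "real k \<ge> 2" using k by simp
  have kx: "real k - 1 < real k * x" "real k * x < real k" using x k0 by (simp_all add: field_simps)
  then have fl: "\<lfloor>real k * x\<rfloor> = int k - 1" by (simp add: floor_eq_iff)
  then have fr: "1 - frac (real k * x) = real k * (1 - x)"
    by (simp add: frac_def algebra_simps)
  show "toy_offset k x T = (real k * (1 - x) - 1 / 2) + (- 1) * T" if "T < real k * (1 - x)"
  proof -
    have "\<lfloor>real k * x + T\<rfloor> = int k - 1" using toy_floor(1)[OF T, of k x] fl fr that by simp
    then have "toy_left k x T = (real k - 1 - T) / real k" "toy_right k x T = (real k - T) / real k"
      using T k0 by (simp_all add: toy_left_def toy_right_def field_simps)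
    then show ?thesis using k0 by (simp add: toy_offset_def field_simps)
  qed
  show "toy_offset k x T = real k * (1 - x) + (- 1 / 2) * T" if "real k * (1 - x) \<le> T"
  proof -
    have "\<lfloor>real k * x + T\<rfloor> = int k" using toy_floor(2)[OF T, of k x] fl fr that by simp
    then have "toy_left k x T = (real k - T) / real k" "toy_right k x T = 1"
      using T k0 by (simp_all add: toy_left_def toy_right_def field_simps)
    then show ?thesis using k0 by (simp add: toy_offset_def field_simps)
  qed
qed

lemma toy_moments_interior:
  assumes "k \<ge> 2" "1 / real k \<le> x" "x \<le> 1 - 1 / real k"
  shows "integral\<^sup>L unif01 (toy_offset k x) = 0"
    and "integral\<^sup>L unif01 (\<lambda>T. (toy_offset k x T)\<^sup>2) = 1 / 12"
proof -
  define f where "f = frac (real k * x)"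
  have f: "0 \<le> 1 - f" "1 - f \<le> 1"
    using frac_lt_1[of "real k * x"] frac_ge_0[of "real k * x"] by (simp_all add: f_def less_imp_le)
  have z1: "toy_offset k x T = (1 / 2 - f) + (- 1) * T" if "0 \<le> T" "T < 1 - f" for T
    using toy_offset_interior(1)[OF assms, of T] that f unfolding f_def by simp
  have z2: "toy_offset k x T = (3 / 2 - f) + (- 1) * T" if "1 - f \<le> T" "T < 1" for T
    using toy_offset_interior(2)[OF assms, of T] that f unfolding f_def by simp
  show "integral\<^sup>L unif01 (toy_offset k x) = 0"
    by (subst moments_unif01_two_affine_pieces(1)[OF f z1 z2])
       (simp_all add: power2_eq_square field_simps)
  show "integral\<^sup>L unif01 (\<lambda>T. (toy_offset k x T)\<^sup>2) = 1 / 12"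
    by (subst moments_unif01_two_affine_pieces(2)[OF f z1 z2])
       (simp_all add: power2_eq_square power3_eq_cube field_simps)
qed

text \<open>The variance of the displacement at the point \<open>x = t/k\<close> with \<open>t\<close> between 0 and 1, as a function of \<open>t\<close>.\<close>

definition toy_Q :: "real poly" where
  "toy_Q = [:1 / 48, 0, 1 / 8, 0, - 1 / 16:]"

lemma poly_toy_Q: "poly toy_Q t = 1 / 48 + t\<^sup>2 / 8 - t ^ 4 / 16"
  by (simp add: toy_Q_def power2_eq_square power4_eq_xxxx field_simps)

lemma abs_toy_Q_le: "0 \<le> t \<Longrightarrow> t \<le> 1 \<Longrightarrow> \<bar>poly toy_Q t\<bar> \<le> 1"
proof -
  assume t: "0 \<le> t" "t \<le> 1"
  have "t ^ 4 \<le> t\<^sup>2" "t\<^sup>2 \<le> 1" "0 \<le> t ^ 4"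
    using t by (auto intro: power_decreasing power_le_one)
  then show ?thesis unfolding poly_toy_Q abs_le_iff by linarith
qed

text \<open>The mean is positive near 0 and negative near 1, since truncation pushes the midpoint inwards.\<close>

lemma toy_moments_boundary:
  assumes k: "k \<ge> 2" and x: "x \<in> {0<..<1} - {1 / real k..1 - 1 / real k}"
  defines "t \<equiv> real k * min x (1 - x)"
  shows "0 \<le> t" "t \<le> 1"
    and "\<bar>integral\<^sup>L unif01 (toy_offset k x)\<bar> = (1 - t)\<^sup>2 / 4"
    and "integral\<^sup>L unif01 (\<lambda>T. (toy_offset k x T)\<^sup>2) - (integral\<^sup>L unif01 (toy_offset k x))\<^sup>2
           = poly toy_Q t"
proof -
  have k0: "real k \<ge> 2" using k by simp
  have half: "1 / real k \<le> 1 / 2" using k0 by (simp add: field_simps)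
  have "(0 \<le> t \<and> t \<le> 1) \<and>
      \<bar>integral\<^sup>L unif01 (toy_offset k x)\<bar> = (1 - t)\<^sup>2 / 4 \<and>
      integral\<^sup>L unif01 (\<lambda>T. (toy_offset k x T)\<^sup>2) - (integral\<^sup>L unif01 (toy_offset k x))\<^sup>2
           = poly toy_Q t"
  proof (cases "x < 1 / real k")
    case True
    have t: "t = real k * x" using True half unfolding t_def by simp
    have t01: "0 \<le> t" "t \<le> 1" using True x k0 by (simp_all add: t field_simps)
    have p: "0 \<le> 1 - t" "1 - t \<le> 1" using t01 by auto
    have z1: "toy_offset k x T = (1 / 2 - t) + (- 1 / 2) * T" if "0 \<le> T" "T < 1 - t" for T
      using toy_offset_left(1)[OF k _ True, of T] that x t01 unfolding t by simp
    have z2: "toy_offset k x T = (3 / 2 - t) + (- 1) * T" if "1 - t \<le> T" "T < 1" for T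
      using toy_offset_left(2)[OF k _ True, of T] that x t01 unfolding t by simp
    have E: "integral\<^sup>L unif01 (toy_offset k x) = (1 - t)\<^sup>2 / 4"
      by (subst moments_unif01_two_affine_pieces(1)[OF p z1 z2])
         (simp_all add: power2_eq_square field_simps)
    have "integral\<^sup>L unif01 (\<lambda>T. (toy_offset k x T)\<^sup>2) = (1 / 2 - t) ^ 3 / 3 + t ^ 3 / 12 + 1 / 24"
      by (subst moments_unif01_two_affine_pieces(2)[OF p z1 z2])
         (simp_all add: power2_eq_square power3_eq_cube field_simps)
    then have "integral\<^sup>L unif01 (\<lambda>T. (toy_offset k x T)\<^sup>2) - (integral\<^sup>L unif01 (toy_offset k x))\<^sup>2
        = poly toy_Q t"
      unfolding E by (simp add: poly_toy_Q power2_eq_square power3_eq_cube power4_eq_xxxx field_simps)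
    then show ?thesis using t01 by (simp add: E)
  next
    case False
    then have r: "1 - 1 / real k < x" "x < 1" using x by auto
    have t: "t = real k * (1 - x)" using r half unfolding t_def by simp
    have t01: "0 \<le> t" "t \<le> 1" using r k0 by (simp_all add: t field_simps)
    have z1: "toy_offset k x T = (t - 1 / 2) + (- 1) * T" if "0 \<le> T" "T < t" for T
      using toy_offset_right(1)[OF k r, of T] that t01 unfolding t by simp
    have z2: "toy_offset k x T = t + (- 1 / 2) * T" if "t \<le> T" "T < 1" for T
      using toy_offset_right(2)[OF k r, of T] that t01 unfolding t by simp
    have E: "integral\<^sup>L unif01 (toy_offset k x) = - ((1 - t)\<^sup>2 / 4)"
      by (subst moments_unif01_two_affine_pieces(1)[OF t01 z1 z2])
         (simp_all add: power2_eq_square field_simps)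
    have "integral\<^sup>L unif01 (\<lambda>T. (toy_offset k x T)\<^sup>2) = (1 / 2 - t) ^ 3 / 3 + t ^ 3 / 12 + 1 / 24"
      by (subst moments_unif01_two_affine_pieces(2)[OF t01 z1 z2])
         (simp_all add: power2_eq_square power3_eq_cube field_simps)
    then have "integral\<^sup>L unif01 (\<lambda>T. (toy_offset k x T)\<^sup>2) - (integral\<^sup>L unif01 (toy_offset k x))\<^sup>2
        = poly toy_Q t"
      unfolding E by (simp add: poly_toy_Q power2_eq_square power3_eq_cube power4_eq_xxxx field_simps)
    then show ?thesis using t01 by (simp add: E)
  qed
  then show "0 \<le> t" "t \<le> 1"
    "\<bar>integral\<^sup>L unif01 (toy_offset k x)\<bar> = (1 - t)\<^sup>2 / 4"
    "integral\<^sup>L unif01 (\<lambda>T. (toy_offset k x T)\<^sup>2) - (integral\<^sup>L unif01 (toy_offset k x))\<^sup>2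
           = poly toy_Q t"
    by auto
qed

section \<open>The mean over the cell\<close>

text \<open>The mean of \<open>s\<close> over the cell of \<open>x\<close> for the shift \<open>T\<close>, defined for all real \<open>x\<close> and \<open>T\<close>.\<close>

definition toy_mean :: "nat \<Rightarrow> (real \<Rightarrow> real) \<Rightarrow> real \<Rightarrow> real \<Rightarrow> real" where
  "toy_mean k s x T =
     (LBINT t:{toy_left k x T..<toy_right k x T}. s t) / (toy_right k x T - toy_left k x T)"

lemma cell_mean_toy_partition:
  assumes "k \<ge> 2" "0 \<le> x" "x < 1" "0 \<le> T" "T < 1"
  shows "cell_mean unif01 s (toy_partition k T) x = toy_mean k s x T"
proof -
  note b = toy_bounds[OF assms(1-3), of T]
  have sub: "{toy_left k x T..<toy_right k x T} \<subseteq> {0..<1}" using b by auto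
  have "measure unif01 {toy_left k x T..<toy_right k x T} = toy_right k x T - toy_left k x T"
    using sub b by (simp add: unif01_def measure_restrict_space)
  moreover have "(LINT t:{toy_left k x T..<toy_right k x T}|unif01. s t)
      = (LBINT t:{toy_left k x T..<toy_right k x T}. s t)"
    unfolding set_lebesgue_integral_def[of unif01] integral_unif01 
    unfolding set_lebesgue_integral_def
    by (rule Bochner_Integration.integral_cong) (use sub in \<open>auto simp: indicator_def\<close>)
  ultimately show ?thesis
    by (simp add: cell_mean_def cell_toy_partition[OF assms] toy_mean_def)
qed

lemma borel_measurable_toy_left [measurable]:
    "(\<lambda>z. toy_left k (fst z) (snd z)) \<in> borel_measurable (borel \<Otimes>\<^sub>M borel)"
  and borel_measurable_toy_right [measurable]:
    "(\<lambda>z. toy_right k (fst z) (snd z)) \<in> borel_measurable (borel \<Otimes>\<^sub>M borel)"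
  unfolding toy_left_def toy_right_def by measurable

lemma borel_measurable_toy_offset: "toy_offset k x \<in> borel_measurable borel"
proof -
  have "(\<lambda>T. (x, T)) \<in> borel \<rightarrow>\<^sub>M borel \<Otimes>\<^sub>M borel" by measurable
  from measurable_compose[OF this borel_measurable_toy_left]
    measurable_compose[OF this borel_measurable_toy_right]
  have [measurable]: "toy_left k x \<in> borel_measurable borel" "toy_right k x \<in> borel_measurable borel"
    by auto
  show ?thesis unfolding toy_offset_def by measurable
qed

lemma borel_measurable_toy_mean:
  assumes [measurable]: "s \<in> borel_measurable borel"
  shows "(\<lambda>z. toy_mean k s (fst z) (snd z)) \<in> borel_measurable (borel \<Otimes>\<^sub>M borel)"
proof -
  have "toy_mean k s x T = (\<integral>t. (if toy_left k x T \<le> t \<and> t < toy_right k x T then s t else 0) \<partial>lborel)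
      / (toy_right k x T - toy_left k x T)" for x T
    unfolding toy_mean_def set_lebesgue_integral_def
    by (intro arg_cong2[where f = "(/)"] Bochner_Integration.integral_cong) auto
  then show ?thesis by simp
qed

text \<open>Only the values of \<open>s\<close> on \<open>[0,1)\<close> matter, so \<open>s\<close> can be replaced by its extension by 0. For
  \<open>s\<close> continuous on \<open>[0,1)\<close> this extension is Borel measurable on the whole line.\<close>

lemma toy_mean_indicator:
  assumes "k \<ge> 2" "0 \<le> x" "x < 1"
  shows "toy_mean k (\<lambda>t. indicator {0..<1} t * s t) x T = toy_mean k s x T"
proof -
  have "{toy_left k x T..<toy_right k x T} \<subseteq> {0..<1}"
    using toy_bounds[OF assms, of T] by auto
  then show ?thesis
    unfolding toy_mean_def
    by (intro arg_cong2[where f = "(/)"] set_lebesgue_integral_cong) auto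
qed

section \<open>Functions with a quadratic Taylor remainder\<close>

text \<open>A function on \<open>[0,1)\<close>, with derivative \<open>s'\<close>, whose first-order Taylor remainder is bounded by
  \<open>C * (t - x)^2\<close>.\<close>

locale quadratic_taylor =
  fixes s s' :: "real \<Rightarrow> real" and C :: real
  assumes deriv: "\<And>x. x \<in> {0..<1} \<Longrightarrow> (s has_real_derivative s' x) (at x within {0..<1})"
    and C_pos: "0 < C"
    and taylor: "\<And>t x. t \<in> {0..<1} \<Longrightarrow> x \<in> {0..<1} \<Longrightarrow> \<bar>s t - s x - s' x * (t - x)\<bar> \<le> C * (t - x)\<^sup>2"
begin

text \<open>Adding the Taylor bounds at \<open>x\<close> and at \<open>t\<close>. It follows that \<open>s'\<close> is continuous and bounded, so that
  its supremum norm is meaningful.\<close>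

lemma deriv_lipschitz:
  assumes "x \<in> {0..<1}" "t \<in> {0..<1}"
  shows "\<bar>s' t - s' x\<bar> \<le> 2 * C * \<bar>t - x\<bar>"
proof (cases "t = x")
  case False
  have "\<bar>(s' t - s' x) * (t - x)\<bar> \<le> 2 * C * (t - x)\<^sup>2"
    using taylor[OF assms(2,1)] taylor[OF assms] by (simp add: algebra_simps power2_commute[of x t] abs_le_iff)
  then have "\<bar>s' t - s' x\<bar> * \<bar>t - x\<bar> \<le> (2 * C * \<bar>t - x\<bar>) * \<bar>t - x\<bar>"
    by (simp add: abs_mult power2_eq_square[symmetric] mult.assoc)
  then show ?thesis using False by simp
qed auto

lemma continuous_on_s: "continuous_on {0..<1} s"
  using deriv by (meson DERIV_continuous continuous_on_eq_continuous_within)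

lemma continuous_on_s': "continuous_on {0..<1} s'"
proof (rule continuous_onI)
  fix x e :: real assume x: "x \<in> {0..<1}" and e: "e > 0"
  show "\<exists>d>0. \<forall>t\<in>{0..<1}. dist t x < d \<longrightarrow> dist (s' t) (s' x) \<le> e"
  proof (intro exI conjI ballI impI)
    show "e / (2 * C) > 0" using e C_pos by simp
    fix t assume t: "t \<in> {0..<1}" "dist t x < e / (2 * C)"
    then have "2 * C * \<bar>t - x\<bar> \<le> e" using C_pos by (simp add: dist_real_def field_simps)
    then show "dist (s' t) (s' x) \<le> e"
      using deriv_lipschitz[OF x t(1)] by (simp add: dist_real_def)
  qed
qed

lemma measurable_s: "(\<lambda>t. indicator {0..<1} t * s t) \<in> borel_measurable borel"
  using borel_measurable_continuous_on_indicator[OF _ continuous_on_s] by simp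

lemma measurable_s': "(\<lambda>t. indicator {0..<1} t * s' t) \<in> borel_measurable borel"
  using borel_measurable_continuous_on_indicator[OF _ continuous_on_s'] by simp

lemma abs_s'_le_sup_norm:
  assumes "x \<in> {0..<1}"
  shows "\<bar>s' x\<bar> \<le> sup_norm s'"
proof -
  have "\<bar>s' x\<bar> \<le> \<bar>s' 0\<bar> + 2 * C" if "x \<in> {0..<1}" for x
  proof -
    have "2 * C * \<bar>x - 0\<bar> \<le> 2 * C * 1" using that C_pos by (intro mult_left_mono) auto
    then show ?thesis using deriv_lipschitz[of 0 x] that by auto
  qed
  then have "bdd_above ((\<lambda>x. \<bar>s' x\<bar>) ` {0..<1})" by (intro bdd_aboveI2) auto
  then show ?thesis unfolding sup_norm_def by (intro cSUP_upper assms)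
qed

lemma sup_norm_nonneg: "0 \<le> sup_norm s'"
  using abs_s'_le_sup_norm[of 0] by simp

lemma bounded_s: "\<exists>b. \<forall>x\<in>{0..<1}. \<bar>s x\<bar> \<le> b"
proof (intro exI ballI)
  fix x :: real assume x: "x \<in> {0..<1}"
  have "\<bar>s' 0 * x\<bar> \<le> \<bar>s' 0\<bar>"
    using x mult_left_mono[of "\<bar>x\<bar>" 1 "\<bar>s' 0\<bar>"] by (simp add: abs_mult)
  moreover have "C * x\<^sup>2 \<le> C"
    using x C_pos mult_left_mono[of "x\<^sup>2" 1 C] by (simp add: power_le_one)
  moreover have "\<bar>s x - s 0 - s' 0 * x\<bar> \<le> C * x\<^sup>2"
    using taylor[of x 0] x by simp
  ultimately show "\<bar>s x\<bar> \<le> \<bar>s 0\<bar> + \<bar>s' 0\<bar> + C"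
    by linarith
qed

lemma set_integrable_s: "set_integrable lborel {0..<1} s"
proof -
  obtain b where b: "\<And>x. x \<in> {0..<1} \<Longrightarrow> \<bar>s x\<bar> \<le> b" using bounded_s by blast
  show ?thesis unfolding set_integrable_def real_scaleR_def
    by (rule integrableI_bounded_set[where A = "{0..<1}" and B = b])
       (use measurable_s b in auto)
qed

lemma interval_mean_remainder:
  assumes "0 \<le> a" "a \<le> x" "x < b" "b \<le> 1"
  shows "\<bar>(LBINT t:{a..<b}. s t) / (b - a) - (s x + s' x * ((a + b) / 2 - x))\<bar>
           \<le> C * ((b - a)\<^sup>2 / 12 + ((a + b) / 2 - x)\<^sup>2)"
proof -
  have ab: "a \<le> b" "0 < b - a" using assms by auto
  have int_s: "set_integrable lborel {a..<b} s"
    by (rule set_integrable_subset[OF set_integrable_s]) (use assms in auto)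
  have lin: "set_integrable lborel {a..<b} (\<lambda>t. s x + s' x * (t - x))"
    "(LBINT t:{a..<b}. s x + s' x * (t - x))
      = (s x * b + s' x * (b - x)\<^sup>2 / 2) - (s x * a + s' x * (a - x)\<^sup>2 / 2)"
    by (rule set_integral_FTC_Ico[OF ab(1), where F = "\<lambda>t. s x * t + s' x * (t - x)\<^sup>2 / 2"];
        auto intro!: derivative_eq_intros continuous_intros)+
  have quad: "set_integrable lborel {a..<b} (\<lambda>t. C * (t - x)\<^sup>2)"
    "(LBINT t:{a..<b}. C * (t - x)\<^sup>2) = C * (b - x) ^ 3 / 3 - C * (a - x) ^ 3 / 3"
    by (rule set_integral_FTC_Ico[OF ab(1), where F = "\<lambda>t. C * (t - x) ^ 3 / 3"];
        auto intro!: derivative_eq_intros continuous_intros)+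
  have "\<bar>(LBINT t:{a..<b}. s t) - (LBINT t:{a..<b}. s x + s' x * (t - x))\<bar>
      = \<bar>LBINT t:{a..<b}. s t - (s x + s' x * (t - x))\<bar>"
    using int_s lin by (simp add: set_integral_diff)
  also have "\<dots> \<le> (LBINT t:{a..<b}. \<bar>s t - (s x + s' x * (t - x))\<bar>)"
    using set_integral_norm_bound[OF set_integral_diff(1)[OF int_s lin(1)]] by simp
  also have "\<dots> \<le> (LBINT t:{a..<b}. C * (t - x)\<^sup>2)"
  proof (rule set_integral_mono)
    show "set_integrable lborel {a..<b} (\<lambda>t. \<bar>s t - (s x + s' x * (t - x))\<bar>)"
      using int_s lin by (intro set_integrable_abs set_integral_diff)
    show "\<bar>s t - (s x + s' x * (t - x))\<bar> \<le> C * (t - x)\<^sup>2" if "t \<in> {a..<b}" for t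
      using taylor[of t x] that assms by (simp add: algebra_simps)
  qed (rule quad)
  finally have *: "\<bar>(LBINT t:{a..<b}. s t) - (LBINT t:{a..<b}. s x + s' x * (t - x))\<bar>
      \<le> (LBINT t:{a..<b}. C * (t - x)\<^sup>2)" .
  have l: "(LBINT t:{a..<b}. s x + s' x * (t - x)) = (b - a) * (s x + s' x * ((a + b) / 2 - x))"
    unfolding lin by (simp add: power2_eq_square field_simps)
  \<comment> \<open>The second moment about \<open>x\<close> of the uniform law on the interval: its variance plus the squared
    displacement of its mean.\<close>
  have q: "(LBINT t:{a..<b}. C * (t - x)\<^sup>2) = (b - a) * (C * ((b - a)\<^sup>2 / 12 + ((a + b) / 2 - x)\<^sup>2))"
    unfolding quad by (simp add: power2_eq_square power3_eq_cube field_simps)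
  have "(LBINT t:{a..<b}. s t) / (b - a) - (s x + s' x * ((a + b) / 2 - x))
      = ((LBINT t:{a..<b}. s t) - (LBINT t:{a..<b}. s x + s' x * (t - x))) / (b - a)"
    unfolding l using ab by (simp add: field_simps)
  then have "\<bar>(LBINT t:{a..<b}. s t) / (b - a) - (s x + s' x * ((a + b) / 2 - x))\<bar>
      = \<bar>(LBINT t:{a..<b}. s t) - (LBINT t:{a..<b}. s x + s' x * (t - x))\<bar> / (b - a)"
    using ab by simp
  also have "\<dots> \<le> (b - a) * (C * ((b - a)\<^sup>2 / 12 + ((a + b) / 2 - x)\<^sup>2)) / (b - a)"
    using * unfolding q using ab by (intro divide_right_mono) auto
  finally show ?thesis using ab by simp
qed

lemma toy_mean_remainder:
  assumes "k \<ge> 2" "0 \<le> x" "x < 1"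
  shows "\<bar>toy_mean k s x T - (s x + s' x / real k * toy_offset k x T)\<bar>
           \<le> C / (real k)\<^sup>2 * (1 / 12 + (toy_offset k x T)\<^sup>2)"
proof -
  note b = toy_bounds[OF assms, of T]
  define l r where "l = toy_left k x T" and "r = toy_right k x T"
  have k: "real k > 0" using assms by simp
  have "(r - l)\<^sup>2 \<le> (1 / real k)\<^sup>2"
    using b unfolding l_def r_def by (intro power_mono) auto
  then have "C * ((r - l)\<^sup>2 / 12 + ((l + r) / 2 - x)\<^sup>2) \<le> C * ((1 / real k)\<^sup>2 / 12 + ((l + r) / 2 - x)\<^sup>2)"
    using C_pos by (intro mult_left_mono) auto
  also have "\<dots> = C / (real k)\<^sup>2 * (1 / 12 + (toy_offset k x T)\<^sup>2)"
    using k unfolding toy_offset_def l_def[symmetric] r_def[symmetric] power_mult_distrib power_divide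
    by (simp add: field_simps)
  finally have "C * ((r - l)\<^sup>2 / 12 + ((l + r) / 2 - x)\<^sup>2) \<le> C / (real k)\<^sup>2 * (1 / 12 + (toy_offset k x T)\<^sup>2)" .
  moreover have "s' x / real k * toy_offset k x T = s' x * ((l + r) / 2 - x)"
    using k by (simp add: toy_offset_def l_def r_def)
  ultimately show ?thesis
    using interval_mean_remainder[OF b(1-4)] by (simp add: toy_mean_def l_def r_def)
qed

section \<open>Pointwise bias and variance\<close>

lemma borel_measurable_toy_mean_indicator [measurable]:
  "(\<lambda>z. toy_mean k (\<lambda>t. indicator {0..<1} t * s t) (fst z) (snd z))
     \<in> borel_measurable (borel \<Otimes>\<^sub>M borel)"
  by (rule borel_measurable_toy_mean[OF measurable_s])

lemma borel_measurable_toy_mean_unif01: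
  assumes "k \<ge> 2" "0 \<le> x" "x < 1"
  shows "toy_mean k s x \<in> borel_measurable unif01"
proof (rule borel_measurable_unif01I)
  have "(\<lambda>T. (x, T)) \<in> borel \<rightarrow>\<^sub>M borel \<Otimes>\<^sub>M borel" by measurable
  from measurable_compose[OF this borel_measurable_toy_mean_indicator[of k]]
  show "toy_mean k s x \<in> borel_measurable borel"
    by (simp add: toy_mean_indicator[OF assms])
qed

lemma expectation_cell_mean:
  assumes "k \<ge> 2" "0 \<le> x" "x < 1"
  shows "integral\<^sup>L unif01 (\<lambda>T. cell_mean unif01 s (toy_partition k T) x)
    = integral\<^sup>L unif01 (toy_mean k s x)"
  by (rule Bochner_Integration.integral_cong) (use cell_mean_toy_partition[OF assms] in auto)

lemma bias_infinite_toy: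
  assumes "k \<ge> 2" "0 \<le> x" "x < 1"
  shows "bias_infinite unif01 unif01 (toy_partition k) s x
    = (integral\<^sup>L unif01 (toy_mean k s x) - s x)\<^sup>2"
  unfolding bias_infinite_def expectation_cell_mean[OF assms] by (rule power2_commute)

lemma partition_var_toy:
  assumes "k \<ge> 2" "0 \<le> x" "x < 1"
  shows "partition_var unif01 unif01 (toy_partition k) s x
    = integral\<^sup>L unif01 (\<lambda>T. (toy_mean k s x T - integral\<^sup>L unif01 (toy_mean k s x))\<^sup>2)"
  unfolding partition_var_def expectation_cell_mean[OF assms]
  by (rule Bochner_Integration.integral_cong) (use cell_mean_toy_partition[OF assms] in auto)

lemma expectation_toy_mean_expansion:
  assumes "k \<ge> 2" "0 \<le> x" "x < 1"
  shows "\<bar>integral\<^sup>L unif01 (toy_mean k s x) - (s x + s' x / real k * integral\<^sup>L unif01 (toy_offset k x))\<bar>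
    \<le> C / (real k)\<^sup>2 * (1 / 12 + integral\<^sup>L unif01 (\<lambda>T. (toy_offset k x T)\<^sup>2))"
  by (rule prob_space.affine_perturbation(1)[OF prob_space_unif01
        borel_measurable_unif01I[OF borel_measurable_toy_offset] borel_measurable_toy_mean_unif01[OF assms]])
     (use toy_bounds(6)[OF assms] toy_mean_remainder[OF assms] C_pos in auto)

lemma partition_var_toy_expansion:
  assumes k: "k \<ge> 2" and x: "0 \<le> x" "x < 1"
  shows "\<bar>partition_var unif01 unif01 (toy_partition k) s x
      - (s' x)\<^sup>2 * (integral\<^sup>L unif01 (\<lambda>T. (toy_offset k x T)\<^sup>2) - (integral\<^sup>L unif01 (toy_offset k x))\<^sup>2)
          / (real k)\<^sup>2\<bar>
    \<le> (2 * sup_norm s' * C + C\<^sup>2) / real k ^ 3" (is "\<bar>?V - ?v\<bar> \<le> _")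
proof -
  have k1: "real k \<ge> 1" using k by simp
  have "\<bar>?V - (s' x / real k)\<^sup>2 * (integral\<^sup>L unif01 (\<lambda>T. (toy_offset k x T)\<^sup>2) - (integral\<^sup>L unif01 (toy_offset k x))\<^sup>2)\<bar>
      \<le> 2 * \<bar>s' x / real k\<bar> * (C / (real k)\<^sup>2) / 3 + (C / (real k)\<^sup>2)\<^sup>2 / 9"
    unfolding partition_var_toy[OF assms]
    by (rule prob_space.affine_perturbation(2)[OF prob_space_unif01
        borel_measurable_unif01I[OF borel_measurable_toy_offset] borel_measurable_toy_mean_unif01[OF assms]])
       (use toy_bounds(6)[OF assms] toy_mean_remainder[OF assms] C_pos in auto)
  then have "\<bar>?V - ?v\<bar> \<le> 2 * \<bar>s' x / real k\<bar> * (C / (real k)\<^sup>2) / 3 + (C / (real k)\<^sup>2)\<^sup>2 / 9"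
    by (simp add: power_divide)
  also have "2 * \<bar>s' x / real k\<bar> * (C / (real k)\<^sup>2) / 3 = 2 * \<bar>s' x\<bar> * C / 3 / real k ^ 3"
    using k1 by (simp add: power2_eq_square power3_eq_cube field_simps)
  also have "\<dots> \<le> 2 * sup_norm s' * C / real k ^ 3"
  proof (rule divide_right_mono)
    have "\<bar>s' x\<bar> * C \<le> sup_norm s' * C"
      using abs_s'_le_sup_norm[of x] x C_pos by (intro mult_right_mono) auto
    moreover have "0 \<le> \<bar>s' x\<bar> * C" using C_pos by simp
    ultimately show "2 * \<bar>s' x\<bar> * C / 3 \<le> 2 * sup_norm s' * C" unfolding mult.assoc by linarith
  qed simp
  also have "(C / (real k)\<^sup>2)\<^sup>2 / 9 = C\<^sup>2 / 9 / real k ^ 4"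
    by (simp add: power_divide)
  also have "\<dots> \<le> C\<^sup>2 / real k ^ 3"
    using k1 by (intro frac_le power_increasing) auto
  finally show ?thesis by (simp add: add_divide_distrib)
qed

lemma bias_interior:
  assumes k: "k \<ge> 2" and x: "1 / real k \<le> x" "x \<le> 1 - 1 / real k"
  shows "bias_infinite unif01 unif01 (toy_partition k) s x \<le> C\<^sup>2 / (36 * real k ^ 4)"
proof -
  have k0: "0 < 1 / real k" using k by simp
  have x01: "0 \<le> x" "x < 1" using x k0 by linarith+
  have "\<bar>integral\<^sup>L unif01 (toy_mean k s x) - s x\<bar> \<le> C / (6 * (real k)\<^sup>2)"
    using expectation_toy_mean_expansion[OF k x01] toy_moments_interior[OF k x] by simp
  from power_mono[OF this, of 2] show ?thesis
    by (simp add: bias_infinite_toy[OF k x01] power_divide power_mult_distrib)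
qed

lemma toy_offset_second_moment_le:
  assumes "k \<ge> 2" "0 \<le> x" "x < 1"
  shows "integral\<^sup>L unif01 (\<lambda>T. (toy_offset k x T)\<^sup>2) \<le> 1 / 4"
proof -
  interpret prob_space unif01 by (rule prob_space_unif01)
  have le: "(toy_offset k x T)\<^sup>2 \<le> 1 / 4" for T
    using power_mono[OF toy_bounds(6)[OF assms, of T], of 2] by (simp add: power_divide)
  have m: "(\<lambda>T. (toy_offset k x T)\<^sup>2) \<in> borel_measurable unif01"
    using borel_measurable_unif01I[OF borel_measurable_toy_offset] by simp
  have "integrable unif01 (\<lambda>T. (toy_offset k x T)\<^sup>2)"
    by (rule integrable_const_bound[where B = "1 / 4", OF _ m]) (use le in auto)
  then have "integral\<^sup>L unif01 (\<lambda>T. (toy_offset k x T)\<^sup>2) \<le> integral\<^sup>L unif01 (\<lambda>T. 1 / 4)"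
    using le by (intro integral_mono) auto
  then show ?thesis using prob_space by simp
qed

lemma bias_boundary:
  assumes k: "k \<ge> 2" and x: "x \<in> {0<..<1} - {1 / real k..1 - 1 / real k}"
  shows "bias_infinite unif01 unif01 (toy_partition k) s x
    \<le> (s' x)\<^sup>2 / (16 * (real k)\<^sup>2) + (C * sup_norm s' + C\<^sup>2) / (2 * real k ^ 3)"
proof -
  have k1: "real k \<ge> 1" using k by simp
  have x01: "0 \<le> x" "x < 1" using x by auto
  note m = toy_moments_boundary[OF k x]
  have "(1 - real k * min x (1 - x))\<^sup>2 \<le> 1"
    using m(1,2) by (intro power_le_one) auto
  then have EZ: "\<bar>integral\<^sup>L unif01 (toy_offset k x)\<bar> \<le> 1 / 4" using m(3) by simp
  have "C / (real k)\<^sup>2 * (1 / 12 + integral\<^sup>L unif01 (\<lambda>T. (toy_offset k x T)\<^sup>2))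
      \<le> C / (real k)\<^sup>2 * (1 / 12 + 1 / 4)"
    using C_pos toy_offset_second_moment_le[OF k x01] by (intro mult_left_mono) auto
  moreover have "\<bar>s' x / real k * integral\<^sup>L unif01 (toy_offset k x)\<bar> \<le> \<bar>s' x\<bar> / real k * (1 / 4)"
    unfolding abs_mult using EZ by (intro mult_mono) auto
  ultimately have mean: "\<bar>integral\<^sup>L unif01 (toy_mean k s x) - s x\<bar>
      \<le> \<bar>s' x\<bar> / real k * (1 / 4) + C / (real k)\<^sup>2 * (1 / 12 + 1 / 4)"
    using expectation_toy_mean_expansion[OF k x01] by linarith
  have square: "(a / \<kappa> * (1 / 4) + C / \<kappa>\<^sup>2 * (1 / 12 + 1 / 4))\<^sup>2
      = a\<^sup>2 / (16 * \<kappa>\<^sup>2) + (C * a / 3) / (2 * \<kappa> ^ 3) + C\<^sup>2 / 9 / \<kappa> ^ 4" if "\<kappa> > 0" for a \<kappa> :: real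
    using that by (simp add: power2_eq_square power3_eq_cube power4_eq_xxxx field_simps)
  from power_mono[OF mean, of 2]
  have "bias_infinite unif01 unif01 (toy_partition k) s x
      \<le> (\<bar>s' x\<bar> / real k * (1 / 4) + C / (real k)\<^sup>2 * (1 / 12 + 1 / 4))\<^sup>2"
    by (simp add: bias_infinite_toy[OF k x01])
  also have "\<dots> = (s' x)\<^sup>2 / (16 * (real k)\<^sup>2) + (C * \<bar>s' x\<bar> / 3) / (2 * real k ^ 3) + C\<^sup>2 / 9 / real k ^ 4"
    using square[of "real k" "\<bar>s' x\<bar>"] k1 by simp
  also have "\<dots> \<le> (s' x)\<^sup>2 / (16 * (real k)\<^sup>2) + (C * sup_norm s') / (2 * real k ^ 3) + C\<^sup>2 / 2 / real k ^ 3"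
  proof (intro add_mono order_refl)
    have "C * \<bar>s' x\<bar> \<le> C * sup_norm s'"
      using abs_s'_le_sup_norm[of x] x01 C_pos by (intro mult_left_mono) auto
    moreover have "0 \<le> C * \<bar>s' x\<bar>" using C_pos by simp
    ultimately show "(C * \<bar>s' x\<bar> / 3) / (2 * real k ^ 3) \<le> (C * sup_norm s') / (2 * real k ^ 3)"
      by (intro divide_right_mono) auto
    show "C\<^sup>2 / 9 / real k ^ 4 \<le> C\<^sup>2 / 2 / real k ^ 3"
      by (rule frac_le) (use k1 in \<open>auto intro: power_increasing\<close>)
  qed
  finally show ?thesis by (simp add: add_divide_distrib)
qed

lemma partition_var_interior:
  assumes k: "k \<ge> 2" and x: "1 / real k \<le> x" "x \<le> 1 - 1 / real k"
  shows "\<bar>partition_var unif01 unif01 (toy_partition k) s x - (s' x)\<^sup>2 / (12 * (real k)\<^sup>2)\<bar>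
    \<le> (2 * sup_norm s' * C + C\<^sup>2) / real k ^ 3"
proof -
  have k0: "0 < 1 / real k" using k by simp
  have "0 \<le> x" "x < 1" using x k0 by linarith+
  from partition_var_toy_expansion[OF k this] show ?thesis
    by (simp add: toy_moments_interior[OF k x])
qed

lemma partition_var_boundary:
  assumes k: "k \<ge> 2" and x: "x \<in> {0<..<1} - {1 / real k..1 - 1 / real k}"
  shows "\<bar>partition_var unif01 unif01 (toy_partition k) s x
      - (s' x)\<^sup>2 * poly toy_Q (real k * min x (1 - x)) / (real k)\<^sup>2\<bar>
    \<le> (2 * sup_norm s' * C + C\<^sup>2) / real k ^ 3"
  using partition_var_toy_expansion[OF k, of x] x toy_moments_boundary(4)[OF k x] by simp

section \<open>Integrated bias and variance\<close>

lemma borel_measurable_bias_partition_var: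
  assumes "k \<ge> 2"
  shows "(\<lambda>x. indicator {0..<1} x * bias_infinite unif01 unif01 (toy_partition k) s x)
    \<in> borel_measurable borel"
    and "(\<lambda>x. indicator {0..<1} x * partition_var unif01 unif01 (toy_partition k) s x)
    \<in> borel_measurable borel"
proof -
  note [measurable] = measurable_s
  let ?m = "toy_mean k (\<lambda>t. indicator {0..<1} t * s t)"
  define E where "E x = (\<integral>T. indicator {0..<1} T * ?m x T \<partial>lborel)" for x
  have [measurable]: "E \<in> borel_measurable borel"
    unfolding E_def by measurable
  have E: "integral\<^sup>L unif01 (toy_mean k s x) = E x" if "x \<in> {0..<1}" for x
    using toy_mean_indicator[OF assms, of x s] that
    by (simp add: integral_unif01 set_lebesgue_integral_def E_def)
  have "(\<lambda>x. indicator {0..<1} x * (E x - indicator {0..<1} x * s x)\<^sup>2) \<in> borel_measurable borel"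
    by measurable
  also have "(\<lambda>x. indicator {0..<1} x * (E x - indicator {0..<1} x * s x)\<^sup>2)
      = (\<lambda>x. indicator {0..<1} x * bias_infinite unif01 unif01 (toy_partition k) s x)"
    using bias_infinite_toy[OF assms] E by (auto simp: fun_eq_iff indicator_def)
  finally show "(\<lambda>x. indicator {0..<1} x * bias_infinite unif01 unif01 (toy_partition k) s x)
    \<in> borel_measurable borel" .
  have "(\<lambda>x. indicator {0..<1} x * (\<integral>T. indicator {0..<1} T * (?m x T - E x)\<^sup>2 \<partial>lborel))
      \<in> borel_measurable borel"
    by measurable
  also have "(\<lambda>x. indicator {0..<1} x * (\<integral>T. indicator {0..<1} T * (?m x T - E x)\<^sup>2 \<partial>lborel))
      = (\<lambda>x. indicator {0..<1} x * partition_var unif01 unif01 (toy_partition k) s x)"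
    using partition_var_toy[OF assms] E toy_mean_indicator[OF assms, of _ s]
    by (auto simp: fun_eq_iff indicator_def[of "{0..<1}" "_ :: real"] integral_unif01 set_lebesgue_integral_def)
  finally show "(\<lambda>x. indicator {0..<1} x * partition_var unif01 unif01 (toy_partition k) s x)
    \<in> borel_measurable borel" .
qed

lemma deriv_square_le:
  assumes "x \<in> {0..<1}"
  shows "(s' x)\<^sup>2 \<le> (sup_norm s')\<^sup>2"
  using power_mono[OF abs_s'_le_sup_norm[OF assms], of 2] by simp

lemma set_integrable_deriv_square: "set_integrable lborel {0..<1} (\<lambda>x. (s' x)\<^sup>2)"
proof (rule set_integrable_boundedI)
  have "(\<lambda>x. indicator {0..<1} x * (s' x)\<^sup>2) = (\<lambda>x. (indicator {0..<1} x * s' x)\<^sup>2)"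
    by (auto simp: fun_eq_iff indicator_def)
  then show "(\<lambda>x. indicator {0..<1} x * (s' x)\<^sup>2) \<in> borel_measurable borel"
    using measurable_s' by simp
  show "\<bar>(s' x)\<^sup>2\<bar> \<le> (sup_norm s')\<^sup>2" if "x \<in> {0<..<1}" for x
    using deriv_square_le[of x] that by simp
qed

lemma bias_boundary_uniform:
  assumes k: "k \<ge> 2" and x: "x \<in> {0<..<1} - {1 / real k..1 - 1 / real k}"
  shows "bias_infinite unif01 unif01 (toy_partition k) s x
    \<le> (sup_norm s')\<^sup>2 / (16 * (real k)\<^sup>2) + (C * sup_norm s' + C\<^sup>2) / (2 * real k ^ 3)"
proof -
  have "(s' x)\<^sup>2 / (16 * (real k)\<^sup>2) \<le> (sup_norm s')\<^sup>2 / (16 * (real k)\<^sup>2)"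
    using deriv_square_le[of x] x by (intro divide_right_mono) auto
  then show ?thesis using bias_boundary[OF assms] by linarith
qed

lemma set_integrable_bias:
  assumes k: "k \<ge> 2"
  shows "set_integrable lborel {0..<1} (bias_infinite unif01 unif01 (toy_partition k) s)"
proof (rule set_integrable_boundedI[OF borel_measurable_bias_partition_var(1)[OF k]])
  fix x :: real assume x: "x \<in> {0<..<1}"
  let ?a = "C\<^sup>2 / (36 * real k ^ 4)"
  let ?b = "(sup_norm s')\<^sup>2 / (16 * (real k)\<^sup>2) + (C * sup_norm s' + C\<^sup>2) / (2 * real k ^ 3)"
  have "0 \<le> ?a" "0 \<le> ?b" using C_pos sup_norm_nonneg by auto
  moreover have "bias_infinite unif01 unif01 (toy_partition k) s x \<le> max ?a ?b"
    using bias_interior[OF k, of x] bias_boundary_uniform[OF k, of x] x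
    by (cases "x \<in> {1 / real k..1 - 1 / real k}") (auto simp: le_max_iff_disj)
  moreover have "0 \<le> bias_infinite unif01 unif01 (toy_partition k) s x"
    by (simp add: bias_infinite_def)
  ultimately show "\<bar>bias_infinite unif01 unif01 (toy_partition k) s x\<bar> \<le> max ?a ?b" by simp
qed

lemma integral_bias_le:
  assumes k: "k \<ge> 2"
  shows "(LBINT x:{0..<1}. bias_infinite unif01 unif01 (toy_partition k) s x)
    \<le> (sup_norm s')\<^sup>2 / (8 * real k ^ 3) + (C * sup_norm s' + 2 * C\<^sup>2) / real k ^ 4"
proof -
  let ?a = "C\<^sup>2 / (36 * real k ^ 4)"
  let ?b = "(sup_norm s')\<^sup>2 / (16 * (real k)\<^sup>2) + (C * sup_norm s' + C\<^sup>2) / (2 * real k ^ 3)"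
  have k0: "real k > 0" using k by simp
  have nn: "0 \<le> ?a" "0 \<le> ?b" using C_pos sup_norm_nonneg by auto
  have "(LBINT x:{0..<1}. bias_infinite unif01 unif01 (toy_partition k) s x) \<le> ?a + 2 * (1 / real k) * ?b"
  proof (rule set_integral_le_two_levels[OF _ _ nn(2) set_integrable_bias[OF k]])
    show "bias_infinite unif01 unif01 (toy_partition k) s x \<le> ?a" if "x \<in> {1 / real k..1 - 1 / real k}" for x
      using bias_interior[OF k, of x] that by simp
    show "bias_infinite unif01 unif01 (toy_partition k) s x \<le> ?a + ?b"
      if "x \<in> {0<..<1} - {1 / real k..1 - 1 / real k}" for x
      using bias_boundary_uniform[OF k that] nn(1) by linarith
  qed (use k in \<open>auto simp: field_simps\<close>)
  also have "\<dots> = (sup_norm s')\<^sup>2 / (8 * real k ^ 3) + (C * sup_norm s' + (1 + 1 / 36) * C\<^sup>2) / real k ^ 4"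
    using k0 by (simp add: power2_eq_square power3_eq_cube power4_eq_xxxx field_simps)
  also have "\<dots> \<le> (sup_norm s')\<^sup>2 / (8 * real k ^ 3) + (C * sup_norm s' + 2 * C\<^sup>2) / real k ^ 4"
    by (intro add_left_mono divide_right_mono mult_right_mono) auto
  finally show ?thesis .
qed

lemma integral_bias_interior_le:
  assumes k: "k \<ge> 2"
  shows "(LBINT x:{1 / real k..1 - 1 / real k}. bias_infinite unif01 unif01 (toy_partition k) s x)
    \<le> C\<^sup>2 / (36 * real k ^ 4)"
proof -
  let ?a = "C\<^sup>2 / (36 * real k ^ 4)" and ?I = "{1 / real k..1 - 1 / real k}"
  have k0: "0 < 1 / real k" "1 / real k \<le> 1 / 2" using k by (auto simp: field_simps)
  have fin: "emeasure lborel {\<delta>..1 - \<delta>} < \<infinity>" if "\<delta> \<le> 1 / 2" for \<delta> :: real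
    using that by simp
  have sub: "{\<delta>..1 - \<delta>} \<subseteq> {0..<1}" if "0 < \<delta>" for \<delta> :: real
    using that by auto
  have "(LBINT x:?I. bias_infinite unif01 unif01 (toy_partition k) s x) \<le> (LBINT x:?I. ?a)"
  proof (rule set_integral_mono)
    show "set_integrable lborel ?I (bias_infinite unif01 unif01 (toy_partition k) s)"
      by (rule set_integrable_subset[OF set_integrable_bias[OF k]]) (use sub[OF k0(1)] in auto)
    show "set_integrable lborel ?I (\<lambda>x. ?a)"
      unfolding set_integrable_def real_scaleR_def
      using fin[OF k0(2)] by (intro integrable_mult_left integrable_real_indicator) auto
  qed (use bias_interior[OF k] in auto)
  also have "\<dots> = (1 - 2 * (1 / real k)) * ?a"
    using k0 by (simp add: set_lebesgue_integral_def)
  also have "\<dots> \<le> 1 * ?a" using k0 by (intro mult_right_mono) auto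
  finally show ?thesis by simp
qed

text \<open>The factor \<open>3/2\<close> absorbs \<open>\<bar>Q - 1/12\<bar> \<le> 13/12\<close>; over two intervals of length \<open>1/k\<close> it contributes
  \<open>3 * N^2 / k^3\<close> to the integral, where \<open>N\<close> is the supremum norm of \<open>s'\<close>.\<close>

lemma partition_var_boundary_uniform:
  assumes k: "k \<ge> 2" and x: "x \<in> {0<..<1} - {1 / real k..1 - 1 / real k}"
  shows "\<bar>partition_var unif01 unif01 (toy_partition k) s x - (s' x)\<^sup>2 / (12 * (real k)\<^sup>2)\<bar>
    \<le> (2 * sup_norm s' * C + C\<^sup>2) / real k ^ 3 + 3 / 2 * (sup_norm s')\<^sup>2 / (real k)\<^sup>2"
proof -
  define q where "q = poly toy_Q (real k * min x (1 - x))"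
  have "\<bar>q\<bar> \<le> 1"
    unfolding q_def using toy_moments_boundary(1,2)[OF assms] by (rule abs_toy_Q_le)
  then have "\<bar>q - 1 / 12\<bar> \<le> 3 / 2" by linarith
  then have "(s' x)\<^sup>2 * \<bar>q - 1 / 12\<bar> \<le> (sup_norm s')\<^sup>2 * (3 / 2)"
    using deriv_square_le[of x] x by (intro mult_mono) auto
  then have "(s' x)\<^sup>2 * \<bar>q - 1 / 12\<bar> / (real k)\<^sup>2 \<le> (sup_norm s')\<^sup>2 * (3 / 2) / (real k)\<^sup>2"
    by (rule divide_right_mono) simp
  moreover have "\<bar>(s' x)\<^sup>2 * q / (real k)\<^sup>2 - (s' x)\<^sup>2 / (12 * (real k)\<^sup>2)\<bar> = (s' x)\<^sup>2 * \<bar>q - 1 / 12\<bar> / (real k)\<^sup>2"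
  proof -
    have "(s' x)\<^sup>2 * q / (real k)\<^sup>2 - (s' x)\<^sup>2 / (12 * (real k)\<^sup>2) = (s' x)\<^sup>2 * (q - 1 / 12) / (real k)\<^sup>2"
      by (simp add: right_diff_distrib diff_divide_distrib)
    then show ?thesis by (simp add: abs_mult)
  qed
  ultimately show ?thesis
    using partition_var_boundary[OF assms] unfolding q_def[symmetric] by linarith
qed

lemma partition_var_deviation_le:
  assumes k: "k \<ge> 2" and x: "x \<in> {0<..<1}"
  shows "\<bar>partition_var unif01 unif01 (toy_partition k) s x - (s' x)\<^sup>2 / (12 * (real k)\<^sup>2)\<bar>
    \<le> (2 * sup_norm s' * C + C\<^sup>2) / real k ^ 3 + 3 / 2 * (sup_norm s')\<^sup>2 / (real k)\<^sup>2"
proof (cases "x \<in> {1 / real k..1 - 1 / real k}")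
  case True
  have "0 \<le> 3 / 2 * (sup_norm s')\<^sup>2 / (real k)\<^sup>2" by simp
  moreover have "1 / real k \<le> x" "x \<le> 1 - 1 / real k" using True by auto
  ultimately show ?thesis using partition_var_interior[OF k, of x] by linarith
qed (use partition_var_boundary_uniform[OF k] x in auto)

lemma set_integrable_partition_var:
  assumes k: "k \<ge> 2"
  shows "set_integrable lborel {0..<1} (partition_var unif01 unif01 (toy_partition k) s)"
proof (rule set_integrable_boundedI[OF borel_measurable_bias_partition_var(2)[OF k]])
  fix x :: real assume x: "x \<in> {0<..<1}"
  have "\<bar>(s' x)\<^sup>2 / (12 * (real k)\<^sup>2)\<bar> \<le> (sup_norm s')\<^sup>2 / (12 * (real k)\<^sup>2)"
    using deriv_square_le[of x] x by (simp add: divide_right_mono)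
  then show "\<bar>partition_var unif01 unif01 (toy_partition k) s x\<bar> \<le> (sup_norm s')\<^sup>2 / (12 * (real k)\<^sup>2) +
      ((2 * sup_norm s' * C + C\<^sup>2) / real k ^ 3 + 3 / 2 * (sup_norm s')\<^sup>2 / (real k)\<^sup>2)"
    using partition_var_deviation_le[OF assms x] by linarith
qed

lemma integral_partition_var:
  assumes k: "k \<ge> 2"
  shows "\<bar>(LBINT x:{0..<1}. partition_var unif01 unif01 (toy_partition k) s x)
      - 1 / (12 * (real k)\<^sup>2) * (LBINT x:{0..<1}. (s' x)\<^sup>2)\<bar>
    \<le> (2 * sup_norm s' * C + C\<^sup>2 + 3 * (sup_norm s')\<^sup>2) / real k ^ 3"
proof -
  let ?V = "partition_var unif01 unif01 (toy_partition k) s"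
  let ?a = "(2 * sup_norm s' * C + C\<^sup>2) / real k ^ 3" and ?b = "3 / 2 * (sup_norm s')\<^sup>2 / (real k)\<^sup>2"
  have k0: "real k > 0" using k by simp
  have i: "set_integrable lborel {0..<1} (\<lambda>x. (s' x)\<^sup>2 / (12 * (real k)\<^sup>2))"
    using set_integrable_deriv_square by (rule set_integrable_divide)
  note d = set_integral_diff[OF set_integrable_partition_var[OF k] i]
  have "\<bar>(LBINT x:{0..<1}. ?V x) - 1 / (12 * (real k)\<^sup>2) * (LBINT x:{0..<1}. (s' x)\<^sup>2)\<bar>
      = \<bar>LBINT x:{0..<1}. ?V x - (s' x)\<^sup>2 / (12 * (real k)\<^sup>2)\<bar>"
    unfolding d(2) by simp
  also have "\<dots> \<le> (LBINT x:{0..<1}. \<bar>?V x - (s' x)\<^sup>2 / (12 * (real k)\<^sup>2)\<bar>)"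
    using set_integral_norm_bound[OF d(1)] by simp
  also have "\<dots> \<le> ?a + 2 * (1 / real k) * ?b"
    by (rule set_integral_le_two_levels[OF _ _ _ set_integrable_abs[OF d(1)]])
       (use partition_var_interior[OF k] partition_var_boundary_uniform[OF k] k in \<open>auto simp: field_simps\<close>)
  also have "\<dots> = (2 * sup_norm s' * C + C\<^sup>2 + 3 * (sup_norm s')\<^sup>2) / real k ^ 3"
    using k0 by (simp add: power2_eq_square power3_eq_cube field_simps)
  finally show ?thesis .
qed

end

section \<open>Bias and variance of toy random partitions\<close>

theorem corollary5:
  "\<exists>Q :: real poly.
     (SUP t\<in>{0..1}. \<bar>poly Q t\<bar>) \<le> 1 \<and>
     (\<forall>(k :: nat) (s :: real \<Rightarrow> real) (s' :: real \<Rightarrow> real) (C2 :: real).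
        k \<ge> 2 \<longrightarrow>
        (\<forall>x\<in>{0..<1}. (s has_real_derivative s' x) (at x within {0..<1})) \<longrightarrow>
        C2 > 0 \<longrightarrow>
        (\<forall>t\<in>{0..<1}. \<forall>x\<in>{0..<1}. \<bar>s t - s x - s' x * (t - x)\<bar> \<le> C2 * (t - x)\<^sup>2) \<longrightarrow>
        (let \<epsilon> = 1 / real k;
             N = sup_norm s';
             B = bias_infinite unif01 unif01 (toy_partition k) s;
             V = partition_var unif01 unif01 (toy_partition k) s
         in
           (\<forall>x\<in>{\<epsilon>..1 - \<epsilon>}.
              B x \<le> C2\<^sup>2 / (36 * real k ^ 4) \<and>
              \<bar>V x - (s' x)\<^sup>2 / (12 * (real k)\<^sup>2)\<bar> \<le> (2 * N * C2 + C2\<^sup>2) / real k ^ 3) \<and>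
           (\<forall>x\<in>{0<..<1} - {\<epsilon>..1 - \<epsilon>}.
              B x \<le> (s' x)\<^sup>2 / (16 * (real k)\<^sup>2) + (C2 * N + C2\<^sup>2) / (2 * real k ^ 3) \<and>
              \<bar>V x - (s' x)\<^sup>2 * poly Q (real k * min x (1 - x)) / (real k)\<^sup>2\<bar>
                \<le> (2 * N * C2 + C2\<^sup>2) / real k ^ 3) \<and>
           set_integrable lborel {0..<1} B \<and>
           set_integrable lborel {0..<1} V \<and>
           set_integrable lborel {0..<1} (\<lambda>x. (s' x)\<^sup>2) \<and>
           (LBINT x:{0..<1}. B x) \<le> N\<^sup>2 / (8 * real k ^ 3) + (C2 * N + 2 * C2\<^sup>2) / real k ^ 4 \<and>
           \<bar>(LBINT x:{0..<1}. V x) - 1 / (12 * (real k)\<^sup>2) * (LBINT x:{0..<1}. (s' x)\<^sup>2)\<bar>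
             \<le> (2 * N * C2 + C2\<^sup>2 + 3 * N\<^sup>2) / real k ^ 3 \<and>
           (LBINT x:{\<epsilon>..1 - \<epsilon>}. B x) \<le> C2\<^sup>2 / (36 * real k ^ 4)))"
proof (intro exI conjI allI impI)
  show "(SUP t\<in>{0..1}. \<bar>poly toy_Q t\<bar>) \<le> 1"
    by (rule cSUP_least) (auto intro: abs_toy_Q_le)
next
  fix k :: nat and s s' :: "real \<Rightarrow> real" and C2 :: real
  assume k: "k \<ge> 2"
    and "\<forall>x\<in>{0..<1}. (s has_real_derivative s' x) (at x within {0..<1})" "C2 > 0"
      "\<forall>t\<in>{0..<1}. \<forall>x\<in>{0..<1}. \<bar>s t - s x - s' x * (t - x)\<bar> \<le> C2 * (t - x)\<^sup>2"
  then interpret quadratic_taylor s s' C2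
    by unfold_locales auto
  show "let \<epsilon> = 1 / real k;
             N = sup_norm s';
             B = bias_infinite unif01 unif01 (toy_partition k) s;
             V = partition_var unif01 unif01 (toy_partition k) s
         in
           (\<forall>x\<in>{\<epsilon>..1 - \<epsilon>}.
              B x \<le> C2\<^sup>2 / (36 * real k ^ 4) \<and>
              \<bar>V x - (s' x)\<^sup>2 / (12 * (real k)\<^sup>2)\<bar> \<le> (2 * N * C2 + C2\<^sup>2) / real k ^ 3) \<and>
           (\<forall>x\<in>{0<..<1} - {\<epsilon>..1 - \<epsilon>}.
              B x \<le> (s' x)\<^sup>2 / (16 * (real k)\<^sup>2) + (C2 * N + C2\<^sup>2) / (2 * real k ^ 3) \<and>
              \<bar>V x - (s' x)\<^sup>2 * poly toy_Q (real k * min x (1 - x)) / (real k)\<^sup>2\<bar>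
                \<le> (2 * N * C2 + C2\<^sup>2) / real k ^ 3) \<and>
           set_integrable lborel {0..<1} B \<and>
           set_integrable lborel {0..<1} V \<and>
           set_integrable lborel {0..<1} (\<lambda>x. (s' x)\<^sup>2) \<and>
           (LBINT x:{0..<1}. B x) \<le> N\<^sup>2 / (8 * real k ^ 3) + (C2 * N + 2 * C2\<^sup>2) / real k ^ 4 \<and>
           \<bar>(LBINT x:{0..<1}. V x) - 1 / (12 * (real k)\<^sup>2) * (LBINT x:{0..<1}. (s' x)\<^sup>2)\<bar>
             \<le> (2 * N * C2 + C2\<^sup>2 + 3 * N\<^sup>2) / real k ^ 3 \<and>
           (LBINT x:{\<epsilon>..1 - \<epsilon>}. B x) \<le> C2\<^sup>2 / (36 * real k ^ 4)"
    unfolding Let_def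
    by (intro conjI ballI bias_boundary[OF k] partition_var_boundary[OF k] set_integrable_bias[OF k]
        set_integrable_partition_var[OF k] set_integrable_deriv_square integral_bias_le[OF k]
        integral_partition_var[OF k] integral_bias_interior_le[OF k])
       (use bias_interior[OF k] partition_var_interior[OF k] in auto)
qed

end
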